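(* Let $\mathcal{F}$ be an arbitrary family of graphs, and let $H \in \mathcal{F}$ be a graph of maximum order in $\mathcal{F}$. Then there is an optimal online algorithm with advice for the Delayed $\mathcal{F}$-Node-Deletion Problem that reads at most $\mathrm{opt} \cdot \log |H| + O(\log \mathrm{opt})$ bits of advice.
   Context: Graphs are finite, simple, undirected, with at least one vertex (the graph left after deletions may be empty). $|G|$ is the number of vertices (order) of $G$; $\log$ is base 2. A graph $G$ is $\mathcal{F}$-free if no $H\in\mathcal{F}$ is isomorphic to an induced subgraph of $G$. Delayed $\mathcal{F}$-Node-Deletion Problem: $\mathcal{F}$ is a fixed nonempty finite family of graphs such that no member is isomorphic to an induced subgraph of another, distinct member. An instance is a graph $G$ with an ordering $v_1,\dots,v_n$ of its vertices. In step $i$, vertex $v_i$ and its adjacencies to $v_1,\dots,v_{i-1}$ are revealed, and the algorithm (not knowing the future vertices or $n$) must output $S_i\subseteq\{v_1,\dots,v_i\}$ such that $G[\{v_1,\dots,v_i\}]-S_i$ is $\mathcal{F}$-free; moreover $S_1\subseteq\dots\subseteq S_n$. The goal is to minimize $|S_n|$. For an instance, $\mathrm{opt}$ is the minimum size of a set $S\subseteq V(G)$ with $G-S$ $\mathcal{F}$-free. An online algorithm with advice is deterministic, and additionally may sequentially read bits from an infinite binary tape. It is optimal if for every instance $I$ there is a tape content $\phi_I$ (chosen by an oracle knowing $I$) with which it outputs a solution of size $\mathrm{opt}(I)$ on $I$. It reads at most $b(\mathrm{opt})$ bits of advice if the $\phi_I$ can be chosen such that, additionally, at most $b(\mathrm{opt}(I))$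 tape bits are read on every instance $I$. The $O$-notation refers to $\mathrm{opt}\to\infty$ with constants depending only on $\mathcal{F}$. *)

theory Defs
  imports
    Complex_Main
    "HOL-Library.Landau_Symbols"
    "Graph_Theory.Pair_Digraph"
    "Graph_Theory.Digraph_Component"
    "Graph_Theory.Digraph_Isomorphism"
begin

text \<open>
  Finite simple undirected graphs are the symmetric digraphs of the locale \<^locale>\<open>graph\<close>.
  The locale admits the graph without vertices; this is what may remain after deletions.
\<close>

definition iso_to_induced :: "('a, 'b) pre_digraph \<Rightarrow> ('c, 'd) pre_digraph \<Rightarrow> bool" where
  "iso_to_induced H G \<longleftrightarrow> (\<exists>K. induced_subgraph K G \<and> digraph_iso H K)"

definition family_free :: "('a, 'b) pre_digraph set \<Rightarrow> ('c, 'd) pre_digraph \<Rightarrow> bool" where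
  "family_free F G \<longleftrightarrow> (\<forall>H\<in>F. \<not> iso_to_induced H G)"

definition forbidden_family :: "('a, 'b) pre_digraph set \<Rightarrow> bool" where
  "forbidden_family F \<longleftrightarrow>
     finite F \<and> F \<noteq> {} \<and>
     (\<forall>H\<in>F. graph H \<and> verts H \<noteq> {}) \<and>
     (\<forall>H\<in>F. \<forall>H'\<in>F. H \<noteq> H' \<longrightarrow> \<not> iso_to_induced H H')"

definition deletion_set ::
    "('a, 'b) pre_digraph set \<Rightarrow> ('c, 'd) pre_digraph \<Rightarrow> 'c set \<Rightarrow> bool" where
  "deletion_set F G S \<longleftrightarrow> S \<subseteq> verts G \<and> family_free F (G \<restriction> (verts G - S))"

definition opt :: "('a, 'b) pre_digraph set \<Rightarrow> ('c, 'd) pre_digraph \<Rightarrow> nat" where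
  "opt F G = (LEAST k. \<exists>S. deletion_set F G S \<and> card S = k)"

text \<open>
  A graph together with an ordering of its vertices is represented by a graph with vertices
  \<open>1, \<dots>, n\<close> in their natural order, so that the name of a vertex carries no information
  besides its position. For the same reason arcs are pairs of vertices.
\<close>

definition ordered_graph :: "nat pair_pre_digraph \<Rightarrow> bool" where
  "ordered_graph G \<longleftrightarrow> pair_graph G \<and> (\<exists>n\<ge>1. pverts G = {1..n})"

definition revealed :: "nat pair_pre_digraph \<Rightarrow> nat \<Rightarrow> (nat, nat \<times> nat) pre_digraph" where
  "revealed G i = with_proj G \<restriction> {1..i}"

definition solution ::
    "('a, 'b) pre_digraph set \<Rightarrow> nat pair_pre_digraph \<Rightarrow> (nat \<Rightarrow> nat set) \<Rightarrow> bool" where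
  "solution F G S \<longleftrightarrow>
     (\<forall>i\<in>{1..card (pverts G)}. deletion_set F (revealed G i) (S i)) \<and>
     (\<forall>i\<in>{1..<card (pverts G)}. S i \<subseteq> S (Suc i))"

text \<open>
  An algorithm maps the graph revealed so far and all advice bits read so far to its next move:
  it reads one more bit, or it answers the current step. Being deterministic, it needs no further
  state, as its earlier moves are determined by these data. There is no restriction on the
  computational power, and an algorithm need not answer on tapes that are of no use to it.
\<close>

datatype move = Read | Answer "nat set"

type_synonym advice_algorithm = "(nat, nat \<times> nat) pre_digraph \<Rightarrow> bool list \<Rightarrow> move"

text \<open>
  \<open>responds A R \<phi> p S q\<close>: shown the graph \<open>R\<close> when the first \<open>p\<close> bits of the tape \<open>\<phi>\<close> have been
  read, \<open>A\<close> answers \<open>S\<close>, after which the first \<open>q\<close> bits have been read.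
\<close>

inductive responds ::
    "advice_algorithm \<Rightarrow> (nat, nat \<times> nat) pre_digraph \<Rightarrow> (nat \<Rightarrow> bool) \<Rightarrow>
     nat \<Rightarrow> nat set \<Rightarrow> nat \<Rightarrow> bool"
  for A R \<phi> where
    answer: "A R (map \<phi> [0..<p]) = Answer S \<Longrightarrow> responds A R \<phi> p S p"
  | read: "A R (map \<phi> [0..<p]) = Read \<Longrightarrow> responds A R \<phi> (Suc p) S q \<Longrightarrow> responds A R \<phi> p S q"

definition run ::
    "advice_algorithm \<Rightarrow> nat pair_pre_digraph \<Rightarrow> (nat \<Rightarrow> bool) \<Rightarrow>
     (nat \<Rightarrow> nat set) \<Rightarrow> (nat \<Rightarrow> nat) \<Rightarrow> bool" where
  "run A G \<phi> S pos \<longleftrightarrow>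
     pos 0 = 0 \<and>
     (\<forall>i\<in>{1..card (pverts G)}. responds A (revealed G i) \<phi> (pos (i - 1)) (S i) (pos i))"

definition optimal_reading_at_most ::
    "advice_algorithm \<Rightarrow> ('a, 'b) pre_digraph set \<Rightarrow> (nat \<Rightarrow> real) \<Rightarrow> bool" where
  "optimal_reading_at_most A F b \<longleftrightarrow>
     (\<forall>G. ordered_graph G \<longrightarrow>
       (\<exists>\<phi> S pos. run A G \<phi> S pos \<and> solution F G S \<and>
          card (S (card (pverts G))) = opt F (with_proj G) \<and>
          real (pos (card (pverts G))) \<le> b (opt F (with_proj G))))"

end

theory Submission
  imports Defs "HOL-Library.Countable_Set"
begin

text \<open>
  Fix an optimal deletion set \<open>X\<close>. As long as the revealed graph minus the vertices deleted so far
  contains a forbidden induced subgraph, the algorithm picks one and deletes one of its vertices.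
  Every forbidden induced subgraph meets \<open>X\<close>, and the advice tells which of its at most \<open>|H|\<close>
  vertices is in \<open>X\<close>. So only vertices of \<open>X\<close> are deleted, and \<open>opt\<close> symbols from an alphabet of
  size \<open>|H|\<close> suffice. They are written as one number of \<open>\<lceil>opt * log |H|\<rceil>\<close> bits, preceded by a
  self-delimiting encoding of \<open>opt\<close>.
\<close>

subsection \<open>Forbidden vertex sets\<close>

text \<open>Induced copies are tracked by their vertex sets only. Whether \<open>U\<close> is such a
  set does not change when further vertices are revealed, so one notion serves all prefixes and the
  whole graph.\<close>

definition obstruction :: "('a, 'b) pre_digraph set \<Rightarrow> ('c, 'd) pre_digraph \<Rightarrow> 'c set \<Rightarrow> bool" where
  "obstruction F G U \<longleftrightarrow> (\<exists>H\<in>F. digraph_iso H (G \<restriction> U))"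

lemma induce_induce_subgraph: "U \<subseteq> V \<Longrightarrow> (G \<restriction> V) \<restriction> U = G \<restriction> U"
  by (auto simp: induce_subgraph_def)

lemma obstruction_induce: "U \<subseteq> V \<Longrightarrow> obstruction F (G \<restriction> V) U \<longleftrightarrow> obstruction F G U"
  by (simp add: obstruction_def induce_induce_subgraph)

text \<open>An induced subgraph is determined by its vertex set, so the quantifier over
  \<open>K\<close> becomes one over sets of vertices.\<close>

lemma iso_to_induced_iff:
  assumes "wf_digraph G"
  shows "iso_to_induced H G \<longleftrightarrow> (\<exists>U\<subseteq>verts G. digraph_iso H (G \<restriction> U))"
proof -
  have "K = G \<restriction> verts K" if "induced_subgraph K G" for K
    using that by (auto simp: induced_subgraph_def subgraph_def compatible_def
        intro!: pre_digraph.equality)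
  moreover have "induced_subgraph (G \<restriction> U) G" if "U \<subseteq> verts G" for U
    using that assms by (rule wf_digraph.induced_induce[rotated])
  ultimately show ?thesis
    unfolding iso_to_induced_def
    by (metis induced_imp_subgraph subgraph_imp_subverts)
qed

lemma family_free_induce_iff:
  assumes "wf_digraph G"
  shows "family_free F (G \<restriction> V) \<longleftrightarrow> (\<forall>U\<subseteq>V. \<not> obstruction F G U)"
proof -
  have "wf_digraph (G \<restriction> V)"
    using assms by (rule wf_digraph.wellformed_induce_subgraph)
  then show ?thesis
    by (auto simp: family_free_def iso_to_induced_iff obstruction_def induce_induce_subgraph)
qed

text \<open>An isomorphism is injective on vertices, so these properties pass from \<open>H\<close>
  to \<open>U\<close>. Nonemptiness guarantees a vertex to delete, and the cardinality bounds the
  advice alphabet.\<close>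

lemma forbidden_obstruction:
  assumes "forbidden_family F" "obstruction F G U"
  shows "finite U" "U \<noteq> {}" "\<exists>H\<in>F. card U = card (verts H)"
proof -
  obtain H f where H: "H \<in> F" "pre_digraph.digraph_isomorphism H f" "G \<restriction> U = app_iso f H"
    using assms(2) by (auto simp: obstruction_def digraph_iso_def)
  have U: "U = iso_verts f ` verts H"
    using arg_cong[OF H(3), of verts] by simp
  interpret graph H
    using assms(1) H(1) by (auto simp: forbidden_family_def)
  show "finite U" "U \<noteq> {}"
    using assms(1) H(1) U by (auto simp: forbidden_family_def)
  show "\<exists>H\<in>F. card U = card (verts H)"
    using H(1) U digraph_isomorphism_inj_on_verts[OF H(2)] card_image by blast
qed

subsection \<open>Greedy deletion with advice\<close>

definition greedy_step ::
    "('a, 'b) pre_digraph set \<Rightarrow> nat list \<Rightarrow> ('c, 'd) pre_digraph \<Rightarrow> 'c set \<Rightarrow> 'c set" where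
  "greedy_step F w R S =
     (if \<exists>U\<subseteq>verts R - S. obstruction F R U
      then insert (from_nat_into (SOME U. U \<subseteq> verts R - S \<and> obstruction F R U) (w ! card S)) S
      else S)"

text \<open>
  For every \<open>w\<close>, the function \<open>from_nat_into\<close> yields a member of the chosen set. Since each step
  adds one vertex, the cardinality of the current set tells how many symbols have been used.
\<close>

lemma greedy_step_cases:
  assumes "forbidden_family F"
  obtains "\<forall>U\<subseteq>verts R - S. \<not> obstruction F R U" "\<And>w. greedy_step F w R S = S"
  | U where "U \<subseteq> verts R - S" "obstruction F R U"
      "\<And>w. greedy_step F w R S = insert (from_nat_into U (w ! card S)) S"
      "\<And>w. from_nat_into U (w ! card S) \<in> U"
proof (cases "\<exists>U\<subseteq>verts R - S. obstruction F R U")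
  case True
  define U where "U = (SOME U. U \<subseteq> verts R - S \<and> obstruction F R U)"
  have U: "U \<subseteq> verts R - S \<and> obstruction F R U"
    unfolding U_def by (rule someI_ex) (use True in blast)
  moreover have "greedy_step F w R S = insert (from_nat_into U (w ! card S)) S" for w
    using True by (simp add: greedy_step_def U_def)
  moreover have "from_nat_into U (w ! card S) \<in> U" for w
    using forbidden_obstruction(2)[OF assms conjunct2[OF U]] by (rule from_nat_into)
  ultimately show ?thesis
    using that(2) by blast
next
  case False
  then have "greedy_step F w R S = S" for w
    unfolding greedy_step_def by (rule if_not_P)
  with False show ?thesis
    using that(1) by blast
qed

lemma fold_greedy_step_mono: "S \<subseteq> fold (greedy_step F w) Rs S"
proof (induction Rs arbitrary: S)
  case (Cons R Rs)
  have "S \<subseteq> greedy_step F w R S"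
    by (auto simp: greedy_step_def)
  with Cons[of "greedy_step F w R S"] show ?case
    by simp
qed simp

lemma fold_greedy_step_subset:
  assumes "forbidden_family F" "\<And>R. R \<in> set Rs \<Longrightarrow> verts R \<subseteq> V" "S \<subseteq> V"
  shows "fold (greedy_step F w) Rs S \<subseteq> V"
  using assms(2,3)
proof (induction Rs arbitrary: S)
  case (Cons R Rs)
  have "verts R \<subseteq> V"
    using Cons.prems(1) by simp
  have "greedy_step F w R S \<subseteq> V"
  proof (rule greedy_step_cases[OF assms(1), of R S])
    fix U assume "U \<subseteq> verts R - S"
      "\<And>w. greedy_step F w R S = insert (from_nat_into U (w ! card S)) S"
      "\<And>w. from_nat_into U (w ! card S) \<in> U"
    with \<open>S \<subseteq> V\<close> \<open>verts R \<subseteq> V\<close> show ?thesis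
      by (metis Diff_subset in_mono insert_subset subset_trans)
  qed (use \<open>S \<subseteq> V\<close> in simp)
  with Cons show ?case
    by simp
qed simp

text \<open>The deleted set only grows, so an obstruction that survives all \<open>k\<close> rounds
  was available in each of them. Hence no round was idle, and each one deleted a new vertex.\<close>

lemma fold_greedy_step_replicate:
  assumes "forbidden_family F" "finite S"
    and "U \<subseteq> verts R - fold (greedy_step F w) (replicate k R) S" "obstruction F R U"
  shows "card S + k \<le> card (fold (greedy_step F w) (replicate k R) S)"
  using assms(2-)
proof (induction k arbitrary: S)
  case (Suc k)
  have step: "U \<subseteq> verts R - fold (greedy_step F w) (replicate k R) (greedy_step F w R S)"
    using Suc.prems(2) by simp
  have "S \<subseteq> fold (greedy_step F w) (replicate (Suc k) R) S"
    by (rule fold_greedy_step_mono)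
  then have "U \<subseteq> verts R - S"
    using Suc.prems(2) by blast
  show ?case
  proof (rule greedy_step_cases[OF assms(1), of R S])
    fix U' assume U': "U' \<subseteq> verts R - S"
      "\<And>w. greedy_step F w R S = insert (from_nat_into U' (w ! card S)) S"
      "\<And>w. from_nat_into U' (w ! card S) \<in> U'"
    have "from_nat_into U' (w ! card S) \<notin> S"
      using U'(1,3) by blast
    then have "card (greedy_step F w R S) = Suc (card S)" "finite (greedy_step F w R S)"
      using Suc.prems(1) U'(2)[of w] by auto
    then show ?thesis
      using Suc.IH[OF _ step Suc.prems(3)] by simp
  qed (use \<open>U \<subseteq> verts R - S\<close> Suc.prems(3) in blast)
qed simp

text \<open>The obstruction chosen in a step depends only on the graph and the current set, so an
  oracle can foresee it and append the index of one of its vertices in \<open>X\<close>. The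
  arbitrary continuation \<open>u\<close> expresses that symbols appended later do not affect
  earlier choices; this is what the induction from the right needs.\<close>

lemma ex_advice:
  assumes F: "forbidden_family F" "\<And>H. H \<in> F \<Longrightarrow> card (verts H) \<le> h"
    and "finite X"
    and hit: "\<And>R U. R \<in> set Rs \<Longrightarrow> U \<subseteq> verts R \<Longrightarrow> obstruction F R U \<Longrightarrow> U \<inter> X \<noteq> {}"
  shows "\<exists>w T. T \<subseteq> X \<and> length w = card T \<and> set w \<subseteq> {..<h} \<and>
           (\<forall>u. fold (greedy_step F (w @ u)) Rs {} = T)"
  using hit
proof (induction Rs rule: rev_induct)
  case Nil
  show ?case
    by (intro exI[of _ "[]"] exI[of _ "{}"]) simp
next
  case (snoc R Rs)
  obtain w T where wT: "T \<subseteq> X" "length w = card T" "set w \<subseteq> {..<h}"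
      "\<And>u. fold (greedy_step F (w @ u)) Rs {} = T"
    using snoc.IH snoc.prems by (metis Un_iff set_append)
  show ?case
  proof (rule greedy_step_cases[OF F(1), of R T])
    assume "\<And>w. greedy_step F w R T = T"
    with wT show ?thesis
      by (intro exI[of _ w] exI[of _ T]) simp
  next
    fix U assume U: "U \<subseteq> verts R - T" "obstruction F R U"
      "\<And>w. greedy_step F w R T = insert (from_nat_into U (w ! card T)) T"
    obtain x where x: "x \<in> U" "x \<in> X"
      using snoc.prems[of R U] U by auto
    have "finite U" "card U \<le> h"
      using forbidden_obstruction[OF F(1) U(2)] F(2) by auto
    \<comment> \<open>On a finite set, \<open>from_nat_into\<close> is a bijection from the indices
      below the cardinality. So the index of \<open>x\<close> is a symbol below
      \<open>h\<close>.\<close>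
    have "x \<in> from_nat_into U ` {..<card U}"
      using bij_betw_imp_surj_on[OF bij_betw_from_nat_into_finite[OF \<open>finite U\<close>]] x(1) by simp
    then obtain a where a: "a < card U" "from_nat_into U a = x"
      by auto
    have "x \<notin> T" "finite T"
      using x(1) U(1) wT(1) \<open>finite X\<close> finite_subset by auto
    show ?thesis
    proof (intro exI conjI allI)
      show "insert x T \<subseteq> X"
        using x wT by simp
      show "length (w @ [a]) = card (insert x T)"
        using wT(2) \<open>x \<notin> T\<close> \<open>finite T\<close> by simp
      show "set (w @ [a]) \<subseteq> {..<h}"
        using wT(3) a(1) \<open>card U \<le> h\<close> by simp
      \<comment> \<open>The induction hypothesis is used with continuation \<open>a # u\<close>. As
        \<open>w\<close> has length \<open>card T\<close>, the symbol read in the new step is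
        exactly \<open>a\<close>.\<close>
      show "fold (greedy_step F ((w @ [a]) @ u)) (Rs @ [R]) {} = insert x T" for u
        using wT(4)[of "a # u"] U(3)[of "w @ a # u"] a(2) by (simp flip: wT(2))
    qed
  qed
qed

subsection \<open>The online strategy\<close>

text \<open>A greedy step deletes at most one vertex, so each prefix is processed \<open>k\<close>
  times. With \<open>k\<close> the size of an optimal deletion set, this replaces a loop that runs
  until no obstruction is left.\<close>

definition rounds :: "nat \<Rightarrow> (nat, 'd) pre_digraph \<Rightarrow> nat \<Rightarrow> (nat, 'd) pre_digraph list" where
  "rounds k G i = concat (map (\<lambda>j. replicate k (G \<restriction> {1..j})) [1..<Suc i])"

text \<open>An \<open>advice_algorithm\<close> has no state, so all earlier steps are replayed from
  the current graph, whose order is the step number. The length of the advice word doubles as the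
  number of rounds.\<close>

definition strategy ::
    "('a, 'b) pre_digraph set \<Rightarrow> nat list \<Rightarrow> (nat, 'd) pre_digraph \<Rightarrow> nat set" where
  "strategy F w R = fold (greedy_step F w) (rounds (length w) R (card (verts R))) {}"

text \<open>Earlier prefixes can be recovered from the current one, so the replay reproduces the
  earlier answers.\<close>

lemma strategy_revealed:
  "strategy F w (revealed G i) = fold (greedy_step F w) (rounds (length w) (with_proj G) i) {}"
proof -
  have "(with_proj G \<restriction> {1..i}) \<restriction> {1..j} = with_proj G \<restriction> {1..j}" if "j \<in> set [1..<Suc i]" for j
    using that by (intro induce_induce_subgraph) auto
  then have "rounds (length w) (with_proj G \<restriction> {1..i}) i = rounds (length w) (with_proj G) i"
    unfolding rounds_def by (intro arg_cong[where f = concat] map_cong) auto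
  then show ?thesis
    by (simp add: strategy_def revealed_def)
qed

lemma strategy_revealed_Suc:
  "strategy F w (revealed G (Suc i)) =
     fold (greedy_step F w) (replicate (length w) (revealed G (Suc i))) (strategy F w (revealed G i))"
  by (simp only: strategy_revealed) (simp add: rounds_def revealed_def)

lemma strategy_subset: "forbidden_family F \<Longrightarrow> strategy F w (revealed G i) \<subseteq> {1..i}"
  unfolding strategy_revealed
  by (rule fold_greedy_step_subset) (auto simp: rounds_def)

lemma deletion_set_revealed_iff:
  assumes "wf_digraph (with_proj G)"
  shows "deletion_set F (revealed G i) S \<longleftrightarrow>
    S \<subseteq> {1..i} \<and> (\<forall>U\<subseteq>{1..i} - S. \<not> obstruction F (with_proj G) U)"
proof -
  have "(with_proj G \<restriction> {1..i}) \<restriction> ({1..i} - S) = with_proj G \<restriction> ({1..i} - S)"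
    by (rule induce_induce_subgraph) auto
  then show ?thesis
    by (simp add: deletion_set_def revealed_def family_free_induce_iff[OF assms])
qed

text \<open>The answers increase and the last one lies in \<open>X\<close>, hence all do. If an
  obstruction survived a step, each of its \<open>card X\<close> rounds would have deleted a vertex,
  so the answer would be all of \<open>X\<close>; but \<open>X\<close> meets every
  obstruction.\<close>

lemma strategy_solution:
  assumes F: "forbidden_family F"
    and G: "wf_digraph (with_proj G)" "pverts G = {1..n}"
    and "finite X" and X: "deletion_set F (with_proj G) X"
    and "length w = card X" and final: "strategy F w (revealed G n) \<subseteq> X"
  shows "solution F G (\<lambda>i. strategy F w (revealed G i))"
proof -
  let ?S = "\<lambda>i. strategy F w (revealed G i)"
  have Suc: "?S i \<subseteq> ?S (Suc i)" for i
    unfolding strategy_revealed_Suc by (rule fold_greedy_step_mono)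
  have subX: "?S i \<subseteq> X" if "i \<le> n" for i
    using lift_Suc_mono_le[of ?S, OF Suc that] final by blast
  have "deletion_set F (revealed G (Suc i)) (?S (Suc i))" if i: "Suc i \<le> n" for i
    unfolding deletion_set_revealed_iff[OF G(1)]
  proof (intro conjI strategy_subset[OF F] allI impI notI)
    fix U assume U: "U \<subseteq> {1..Suc i} - ?S (Suc i)" "obstruction F (with_proj G) U"
    have "finite (?S i)"
      using subX[of i] i \<open>finite X\<close> finite_subset by auto
    moreover have "obstruction F (revealed G (Suc i)) U"
      using U by (subst revealed_def, subst obstruction_induce) auto
    moreover have "U \<subseteq> verts (revealed G (Suc i)) - ?S (Suc i)"
      using U(1) by (simp add: revealed_def)
    ultimately have "card (?S i) + length w \<le> card (?S (Suc i))"
      unfolding strategy_revealed_Suc by (intro fold_greedy_step_replicate[OF F])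
    then have "?S (Suc i) = X"
      using \<open>length w = card X\<close> card_seteq[OF \<open>finite X\<close> subX[OF i]] by simp
    then have "U \<subseteq> pverts G - X"
      using U(1) i G(2) by auto
    then show False
      using X U(2) by (simp add: deletion_set_def family_free_induce_iff[OF G(1)])
  qed
  then show ?thesis
    using Suc G(2) unfolding solution_def
    by (metis atLeastAtMost_iff card_atLeastAtMost diff_Suc_1 not0_implies_Suc not_one_le_zero)
qed

text \<open>Obstructions are nonempty, so deleting all vertices is admissible and the minimum
  exists.\<close>

lemma opt_attained:
  assumes "forbidden_family F" "wf_digraph G"
  obtains X where "deletion_set F G X" "card X = opt F G"
proof -
  have "deletion_set F G (verts G)"
    using forbidden_obstruction(2)[OF assms(1)]
    by (auto simp: deletion_set_def family_free_induce_iff[OF assms(2)])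
  then have "\<exists>k S. deletion_set F G S \<and> card S = k"
    by blast
  from LeastI_ex[OF this] show ?thesis
    using that by (auto simp: opt_def)
qed

lemma opt_le: "deletion_set F G S \<Longrightarrow> opt F G \<le> card S"
  unfolding opt_def by (rule Least_le) blast

lemma ex_optimal_advice:
  assumes F: "forbidden_family F" "\<And>H. H \<in> F \<Longrightarrow> card (verts H) \<le> h" and "h > 0"
    and G: "ordered_graph G"
  shows "\<exists>w\<in>lists {..<h}. length w = opt F (with_proj G) \<and>
    solution F G (\<lambda>i. strategy F w (revealed G i)) \<and>
    card (strategy F w (revealed G (card (pverts G)))) = opt F (with_proj G)"
proof -
  obtain n where n: "n \<ge> 1" "pverts G = {1..n}"
    using G by (auto simp: ordered_graph_def)
  interpret pair_graph G
    using G by (simp add: ordered_graph_def)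
  have wf: "wf_digraph (with_proj G)"
    by (rule wf_digraph_axioms)
  obtain X where X: "deletion_set F (with_proj G) X" "card X = opt F (with_proj G)"
    by (rule opt_attained[OF F(1) wf])
  have "finite X"
    using X(1) n(2) finite_subset by (auto simp: deletion_set_def)
  let ?Rs = "rounds (card X) (with_proj G) n"
  have "U \<inter> X \<noteq> {}" if R: "R \<in> set ?Rs" "U \<subseteq> verts R" "obstruction F R U" for R U
  proof
    assume "U \<inter> X = {}"
    obtain j where j: "R = with_proj G \<restriction> {1..j}" "j \<le> n"
      using R(1) by (auto simp: rounds_def)
    then have "U \<subseteq> pverts G - X" "obstruction F (with_proj G) U"
      using R(2,3) \<open>U \<inter> X = {}\<close> n(2) by (auto simp: obstruction_induce)
    then show False
      using X(1) by (simp add: deletion_set_def family_free_induce_iff[OF wf])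
  qed
  then have "\<exists>w T. T \<subseteq> X \<and> length w = card T \<and> set w \<subseteq> {..<h} \<and>
      (\<forall>u. fold (greedy_step F (w @ u)) ?Rs {} = T)"
    by (intro ex_advice[OF F \<open>finite X\<close>])
  then obtain v T where
      "T \<subseteq> X \<and> length v = card T \<and> set v \<subseteq> {..<h} \<and>
        (\<forall>u. fold (greedy_step F (v @ u)) ?Rs {} = T)"
    by (elim exE) (rule that)
  then have v: "T \<subseteq> X" "length v = card T" "set v \<subseteq> {..<h}"
      "\<And>u. fold (greedy_step F (v @ u)) ?Rs {} = T"
    by simp_all
  \<comment> \<open>The number of rounds in \<open>?Rs\<close> was fixed as \<open>card X\<close>
    beforehand, but \<open>T\<close> might be smaller than \<open>X\<close> at this point. Padding
    gives \<open>w\<close> the matching length and, by the choice of \<open>v\<close>, leaves the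
    result \<open>T\<close> unchanged.\<close>
  define w where "w = v @ replicate (card X - card T) 0"
  have len: "length w = card X"
    using v(2) card_mono[OF \<open>finite X\<close> v(1)] by (simp add: w_def)
  have T: "strategy F w (revealed G n) = T"
    unfolding strategy_revealed len using v(4) by (simp add: w_def)
  have sol: "solution F G (\<lambda>i. strategy F w (revealed G i))"
    using strategy_solution[OF F(1) wf n(2) \<open>finite X\<close> X(1) len] T v(1) by simp
  \<comment> \<open>After the last step \<open>T\<close> is a deletion set of the whole graph. Being
    contained in the optimal set \<open>X\<close>, it has optimal size as well.\<close>
  then have "deletion_set F (revealed G n) T"
    using n T by (auto simp: solution_def)
  then have "deletion_set F (with_proj G) T"
    by (simp add: deletion_set_revealed_iff[OF wf])
       (simp add: deletion_set_def family_free_induce_iff[OF wf] n(2))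
  then have "card T = opt F (with_proj G)"
    using opt_le[of F "with_proj G" T] card_mono[OF \<open>finite X\<close> v(1)] X(2) by simp
  moreover have "w \<in> lists {..<h}"
    using v(3) \<open>h > 0\<close> by (auto simp: w_def)
  ultimately show ?thesis
    using sol len X(2) T n(2) by auto
qed

subsection \<open>A prefix-free code\<close>

lemma ex_fixed_length_code:
  assumes "finite A" "card A \<le> 2 ^ m"
  shows "\<exists>c :: 'a \<Rightarrow> bool list. inj_on c A \<and> (\<forall>x\<in>A. length (c x) = m)"
proof -
  let ?B = "{xs :: bool list. set xs \<subseteq> UNIV \<and> length xs = m}"
  have "card ?B = 2 ^ m"
    by (subst card_lists_length_eq) auto
  moreover have "finite ?B"
    by (rule finite_lists_length_eq) simp
  ultimately obtain c where "c ` A \<subseteq> ?B" "inj_on c A"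
    using card_le_inj[OF assms(1), of ?B] assms(2) by auto
  then show ?thesis
    by (intro exI[of _ c]) auto
qed

text \<open>The bound covers the empty word, because \<open>log 2 0 = 0\<close>.\<close>

lemma ex_prefix_code:
  assumes "h > 0"
  obtains c :: "nat list \<Rightarrow> bool list" where
    "\<And>w. w \<in> lists {..<h} \<Longrightarrow>
       real (length (c w)) \<le> real (length w) * log 2 h + (2 * log 2 (length w) + 4)"
    "\<And>w w' p. w \<in> lists {..<h} \<Longrightarrow> w' \<in> lists {..<h} \<Longrightarrow> c w = take p (c w') \<Longrightarrow> w = w'"
proof -
  \<comment> \<open>\<open>L k\<close> is the binary length of \<open>k\<close>, with
    \<open>L 0 = 0\<close>, and \<open>M k\<close> is a number of bits that suffices for the
    \<open>h ^ k\<close> words of length \<open>k\<close>.\<close>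
  define L where "L k = (LEAST l. k < (2::nat) ^ l)" for k
  define M where "M k = nat \<lceil>real k * log 2 h\<rceil>" for k
  have L: "k < 2 ^ L k" for k
    unfolding L_def by (rule LeastI[of _ k]) (rule less_exp)
  have L_le: "real (L k) \<le> log 2 k + 1" if "k > 0" for k
  proof -
    obtain l where l: "L k = Suc l"
      using L[of k] \<open>k > 0\<close> by (cases "L k") auto
    then have "\<not> k < 2 ^ l"
      using not_less_Least[of l "\<lambda>l. k < 2 ^ l"] by (simp add: L_def)
    then have "real (2 ^ l) \<le> real k"
      by (simp only: of_nat_le_iff not_less)
    then have "real l \<le> log 2 k"
      using that by (simp add: le_log_iff powr_realpow)
    with l show ?thesis
      by simp
  qed
  have log_h: "log 2 h \<ge> 0"
    using \<open>h > 0\<close> by simp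
  have "\<exists>c :: nat \<Rightarrow> bool list. inj_on c {..<2 ^ l} \<and> (\<forall>x\<in>{..<2 ^ l}. length (c x) = l)" for l
    by (rule ex_fixed_length_code) auto
  then obtain d :: "nat \<Rightarrow> nat \<Rightarrow> bool list" where d:
      "\<And>l. inj_on (d l) {..<2 ^ l}" "\<And>l x. x < 2 ^ l \<Longrightarrow> length (d l x) = l"
    by (metis lessThan_iff)
  let ?W = "\<lambda>k. {w. set w \<subseteq> {..<h} \<and> length w = k}"
  have "\<exists>c :: nat list \<Rightarrow> bool list. inj_on c (?W k) \<and> (\<forall>w\<in>?W k. length (c w) = M k)" for k
  proof (rule ex_fixed_length_code)
    have "real (card (?W k)) = real h ^ k"
      by (simp add: card_lists_length_eq)
    also have "\<dots> = (2 powr log 2 h) powr real k"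
      using \<open>h > 0\<close> by (simp add: powr_realpow)
    also have "\<dots> = 2 powr (real k * log 2 h)"
      by (simp only: powr_powr mult.commute)
    also have "\<dots> \<le> 2 powr real (M k)"
      using log_h by (intro powr_mono) (auto simp: M_def)
    also have "\<dots> = real (2 ^ M k)"
      by (simp add: powr_realpow)
    finally show "card (?W k) \<le> 2 ^ M k"
      by (simp only: of_nat_le_iff)
  qed (simp add: finite_lists_length_eq)
  then have "\<exists>e :: nat \<Rightarrow> nat list \<Rightarrow> bool list.
      \<forall>k. inj_on (e k) (?W k) \<and> (\<forall>w\<in>?W k. length (e k w) = M k)"
    by (intro choice allI)
  then obtain e :: "nat \<Rightarrow> nat list \<Rightarrow> bool list" where e:
      "\<And>k. inj_on (e k) (?W k)" "\<And>k w. w \<in> ?W k \<Longrightarrow> length (e k w) = M k"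
    by blast
  \<comment> \<open>The unary block ended by \<open>False\<close> gives the size of the block
    \<open>d\<close>, which holds the word length in binary; that length in turn gives the size of
    the block \<open>e\<close>, which holds the word itself.\<close>
  define c where "c w = replicate (L (length w)) True @ False #
    d (L (length w)) (length w) @ e (length w) w" for w
  have len: "length (c w) = 2 * L (length w) + 1 + M (length w)" if "w \<in> lists {..<h}" for w
    using that d(2)[OF L] e(2)[of w "length w"] by (auto simp: c_def)
  show thesis
  proof (rule that)
    fix w assume w: "w \<in> lists {..<h}"
    have "real (M (length w)) \<le> real (length w) * log 2 h + 1"
      using log_h by (simp add: M_def of_nat_nat)
    \<comment> \<open>The summand 2 collects the bit \<open>False\<close> and the rounding in
      \<open>M\<close>; the bound on \<open>L\<close> contributes the other 2.\<close>
    moreover have "2 * real (L (length w)) + 2 \<le> 2 * log 2 (length w) + 4"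
    proof (cases "length w = 0")
      case True
      moreover have "L 0 = 0"
        unfolding L_def by (rule Least_eq_0) simp
      ultimately show ?thesis
        by (simp add: log_def)
    next
      case False
      with L_le[of "length w"] show ?thesis
        by simp
    qed
    ultimately show "real (length (c w)) \<le> real (length w) * log 2 h + (2 * log 2 (length w) + 4)"
      using len[OF w] by simp
  next
    fix w w' p assume w: "w \<in> lists {..<h}" "w' \<in> lists {..<h}" and "c w = take p (c w')"
    then obtain u where u: "c w' = c w @ u"
      by (metis append_take_drop_id)
    \<comment> \<open>The leading bits \<open>True\<close> end at the separator whatever follows, so
      they determine \<open>L\<close>. The remaining blocks are then compared one by one, each
      having the same length on both sides.\<close>
    have unary: "takeWhile id (c w @ v) = replicate (L (length w)) True" for w v
      by (simp add: c_def takeWhile_append)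
    have "L (length w) = L (length w')"
      using unary[of w u] unary[of w' "[]"] u by (metis append_Nil2 length_replicate)
    then have "d (L (length w)) (length w') @ e (length w') w' =
        d (L (length w)) (length w) @ e (length w) w @ u"
      using u by (simp add: c_def)
    moreover have "length (d (L (length w)) (length w')) = length (d (L (length w)) (length w))"
      using \<open>L (length w) = L (length w')\<close> d(2)[OF L] by metis
    ultimately have eq: "d (L (length w)) (length w') = d (L (length w)) (length w)"
        "e (length w') w' = e (length w) w @ u"
      by auto
    have "length w' \<in> {..<2 ^ L (length w)}" "length w \<in> {..<2 ^ L (length w)}"
      using L[of "length w'"] L[of "length w"] \<open>L (length w) = L (length w')\<close> by simp_all
    then have k: "length w' = length w"
      by (rule inj_onD[OF d(1) eq(1)])
    have W: "w \<in> ?W (length w)" "w' \<in> ?W (length w)"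
      using w k by auto
    have "length (e (length w) w') = length (e (length w) w)"
      using e(2)[OF W(1)] e(2)[OF W(2)] by simp
    then have "e (length w) w = e (length w) w'"
      using eq(2) k by simp
    then show "w = w'"
      using W by (rule inj_onD[OF e(1)])
  qed
qed

section \<open>From a prefix-free code to an online algorithm with advice\<close>

text \<open>The algorithm reads until its bits form a codeword. Prefix-freeness makes it stop
  exactly at the end of \<open>c w\<close>, without knowing the length in advance. All reading
  happens in the first step; later steps decode the same bits and answer at once.\<close>

lemma optimal_reading_at_most_prefix_code:
  fixes c :: "'w \<Rightarrow> bool list"
  assumes prefix: "\<And>w w' p. w \<in> W \<Longrightarrow> w' \<in> W \<Longrightarrow> c w = take p (c w') \<Longrightarrow> w = w'"
    and W: "\<And>G. ordered_graph G \<Longrightarrow> \<exists>w\<in>W. solution F G (\<lambda>i. s w (revealed G i)) \<and>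
      card (s w (revealed G (card (pverts G)))) = opt F (with_proj G) \<and>
      real (length (c w)) \<le> b (opt F (with_proj G))"
  shows "\<exists>A. optimal_reading_at_most A F b"
proof -
  define A where "A R bs = (if bs \<in> c ` W then Answer (s (inv_into W c bs) R) else Read)" for R bs
  have "inj_on c W"
    using prefix by (metis inj_onI order_refl take_all)
  \<comment> \<open>Every start \<open>p\<close> up to the codeword length is covered, by induction
    downwards from the full codeword. The cases that occur are \<open>p = 0\<close> in the first
    step and the full length afterwards.\<close>
  have responds: "responds A R \<phi> p (s w R) (length (c w))"
    if "w \<in> W" and \<phi>: "map \<phi> [0..<length (c w)] = c w" and "p \<le> length (c w)" for R \<phi> w p
    using \<open>p \<le> length (c w)\<close>
  proof (induction p rule: inc_induct)
    case base
    show ?case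
      using \<phi> \<open>w \<in> W\<close> \<open>inj_on c W\<close> by (intro responds.answer) (simp add: A_def)
  next
    case (step p)
    have "map \<phi> [0..<p] = take p (c w)"
      using \<phi> step.hyps by (metis add_0 less_imp_le take_map take_upt)
    moreover have "take p (c w) \<notin> c ` W"
    proof
      assume "take p (c w) \<in> c ` W"
      then obtain w' where "w' \<in> W" "c w' = take p (c w)"
        by (rule imageE) simp
      then have "c w = take p (c w)"
        using prefix[OF _ \<open>w \<in> W\<close>] by force
      then have "length (c w) = min (length (c w)) p"
        by (metis length_take)
      with step.hyps show False
        by simp
    qed
    ultimately have "A R (map \<phi> [0..<p]) = Read"
      by (simp add: A_def)
    then show ?case
      using step.IH by (rule responds.read)
  qed
  have "optimal_reading_at_most A F b"
    unfolding optimal_reading_at_most_def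
  proof (intro allI impI)
    fix G assume G: "ordered_graph G"
    obtain w where w: "w \<in> W" "solution F G (\<lambda>i. s w (revealed G i))"
        "card (s w (revealed G (card (pverts G)))) = opt F (with_proj G)"
        "real (length (c w)) \<le> b (opt F (with_proj G))"
      using W[OF G] by blast
    have "card (pverts G) \<noteq> 0"
      using G by (auto simp: ordered_graph_def)
    \<comment> \<open>The tape is of interest only up to the end of the codeword; indices beyond it
      give unspecified bits, which the run never reads.\<close>
    define \<phi> where "\<phi> j = c w ! j" for j
    have "map \<phi> [0..<length (c w)] = c w"
      by (simp add: \<phi>_def[abs_def] map_nth)
    then have "run A G \<phi> (\<lambda>i. s w (revealed G i)) (\<lambda>i. if i = 0 then 0 else length (c w))"
      by (auto simp: run_def intro!: responds[OF w(1)])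
    with w(2-4) \<open>card (pverts G) \<noteq> 0\<close>
    show "\<exists>\<phi> S pos. run A G \<phi> S pos \<and> solution F G S \<and>
        card (S (card (pverts G))) = opt F (with_proj G) \<and>
        real (pos (card (pverts G))) \<le> b (opt F (with_proj G))"
      by (intro exI[of _ \<phi>] exI[of _ "\<lambda>i. s w (revealed G i)"]
          exI[of _ "\<lambda>i. if i = 0 then 0 else length (c w)"]) auto
  qed
  then show ?thesis
    by blast
qed

theorem theorem1:
  fixes F :: "('a, 'b) pre_digraph set" and H :: "('a, 'b) pre_digraph"
  assumes "forbidden_family F"
    and "H \<in> F"
    and "\<forall>H'\<in>F. card (verts H') \<le> card (verts H)"
  shows "\<exists>(A :: advice_algorithm) (f :: nat \<Rightarrow> real).
    f \<in> O(\<lambda>k. log 2 (real k)) \<and>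
    optimal_reading_at_most A F (\<lambda>k. real k * log 2 (real (card (verts H))) + f k)"
proof -
  let ?h = "card (verts H)"
  let ?f = "\<lambda>k::nat. 2 * log 2 (real k) + 4"
  interpret graph H
    using assms(1,2) by (simp add: forbidden_family_def)
  have "?h > 0"
    using assms(1,2) by (simp add: forbidden_family_def card_gt_0_iff)
  have le: "card (verts H') \<le> ?h" if "H' \<in> F" for H'
    using assms(3) that by blast
  obtain c :: "nat list \<Rightarrow> bool list" where c:
    "\<And>w. w \<in> lists {..<?h} \<Longrightarrow>
       real (length (c w)) \<le> real (length w) * log 2 ?h + (2 * log 2 (length w) + 4)"
    "\<And>w w' p. w \<in> lists {..<?h} \<Longrightarrow> w' \<in> lists {..<?h} \<Longrightarrow> c w = take p (c w') \<Longrightarrow> w = w'"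
    using ex_prefix_code[OF \<open>?h > 0\<close>] by metis
  have "\<exists>A. optimal_reading_at_most A F (\<lambda>k. real k * log 2 (real ?h) + ?f k)"
  proof (rule optimal_reading_at_most_prefix_code[OF c(2)])
    fix G assume "ordered_graph G"
    from ex_optimal_advice[OF assms(1) le \<open>?h > 0\<close> this] c(1)
    show "\<exists>w\<in>lists {..<?h}. solution F G (\<lambda>i. strategy F w (revealed G i)) \<and>
        card (strategy F w (revealed G (card (pverts G)))) = opt F (with_proj G) \<and>
        real (length (c w)) \<le> real (opt F (with_proj G)) * log 2 (real ?h) + ?f (opt F (with_proj G))"
      by metis
  qed
  moreover have "?f \<in> O(\<lambda>k. log 2 (real k))"
  \<comment> \<open>For \<open>k \<ge> 2\<close> the logarithm is at least 1, so the constant 4 is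
    at most four times it, and 2 + 4 = 6.\<close>
  proof (rule bigoI[where c = 6])
    show "\<forall>\<^sub>F k in at_top. norm (?f k) \<le> 6 * norm (log 2 (real k))"
      using eventually_ge_at_top[of 2]
    proof eventually_elim
      case (elim k)
      then have "log 2 (real k) \<ge> 1"
        by (simp add: le_log_iff)
      then show ?case
        by simp
    qed
  qed
  ultimately show ?thesis
    by blast
qed

end
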